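(* Let $(v^+[i])_{i\ge 1}$, $(p^+[i])_{i\ge1}$ in $\mathbb{R}^2$ be the post-impact CoM velocities and positions resulting from applying, at every step, a solution of the model predictive planning problem described in the context; in particular its four stability constraints hold for every $i\ge 0$. Then $v^+$ is uniformly ultimately bounded around $v^+_d$: there exist $b,c>0$ such that for every $0<a<c$ there exists $N=N(a,b)\in\mathbb{N}_+$ (depending on $a,b$ and the constants of the problem, but not on $i_0$ or on the particular sequence) such that for every $i_0\ge 1$ $$\|v^+[i_0]-v^+_d[i_0]\|\le a\ \Longrightarrow\ \|v^+[i]-v^+_d[i]\|\le b\quad\text{for all } i\ge i_0+N .$$
   Context: A bipedal robot takes steps numbered $i=0,1,2,\dots$, with stance legs alternating between right ($R$) and left ($L$). $p^+[i]=(p^+_x[i],p^+_y[i])$ and $v^+[i]=(v^+_x[i],v^+_y[i])$ are the horizontal centre-of-mass (CoM) position and velocity relative to the stance foot just after the impact starting step $i$. The desired values are constants $v^+_{x,d},p^+_{x,d}$ and, for the lateral direction, ${}_Rv^+_{y,d},{}_Rp^+_{y,d}$ (used when the right leg is the stance leg) and ${}_Lv^+_{y,d},{}_Lp^+_{y,d}$ (used when the left leg is the stance leg). Write $v^+_d[i]=(v^+_{x,d},{}_Rv^+_{y,d})$ if the stance leg of step $i$ is the right one and $v^+_d[i]=(v^+_{x,d},{}_Lv^+_{y,d})$ otherwise. $\|\cdot\|$ is the Euclidean norm (absolute value for scalars). Planning problem at step $i$ (right leg in stance at step $i$), at time $t_0$ since the last impact: over whole-body trajectories $\varphi(t)$ and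 step durations $T^i_t,T^{i+1}_t$, minimize $\int_{t_0}^{T^i_t+T^{i+1}_t}\|\tau_{\varphi(t)}\cdot\omega_{\varphi(t)}\|^2dt$ (with $\tau_{\varphi(t)},\omega_{\varphi(t)}$ the joint torques and velocities achieving $\varphi(t)$) subject to joint position, velocity and torque constraints, ground reaction force constraints, and the four stability constraints 1. $\|v^+_x[i+2]-v^+_{x,d}\|\le k_1\|v^+_x[i+1]-v^+_{x,d}\|+\epsilon_x$, 2. $\|v^+_y[i+2]-{}_Rv^+_{y,d}\|\le k_2\|v^+_y[i+1]-{}_Lv^+_{y,d}\|+\epsilon_y$, 3. $\|p^+_x[i+2]-p^+_{x,d}\|\le k_3\|(v^+_x[i+2],v^+_y[i+2])-(v^+_{x,d},{}_Rv^+_{y,d})\|$, 4. $\|p^+_y[i+2]-{}_Rp^+_{y,d}\|\le k_4\|(v^+_x[i+2],v^+_y[i+2])-(v^+_{x,d},{}_Rv^+_{y,d})\|$. If the left leg is in stance at step $i$, the subscripts $R$ and $L$ are swapped. Here $k_1,k_2\in(0,1)$, $k_3,k_4\in(0,\infty)$ and $\epsilon_x,\epsilon_y\ge 0$ are fixed constants. The problem is solved in a receding-horizon fashion at every step, so the stability constraints hold along the realized sequence for every $i\ge0$. *)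

theory Defs
  imports "HOL-Analysis.Analysis"
begin

datatype leg = Right_Leg | Left_Leg

fun other_leg :: "leg \<Rightarrow> leg" where
  "other_leg Right_Leg = Left_Leg"
| "other_leg Left_Leg = Right_Leg"

text \<open>Stance leg of step \<open>i\<close>, when \<open>s0\<close> is the stance leg of step \<open>0\<close>.\<close>

definition stance :: "leg \<Rightarrow> nat \<Rightarrow> leg" where
  "stance s0 i = (if even i then s0 else other_leg s0)"

text \<open>Horizontal vectors \<open>(x, y)\<close> are pairs; the norm of \<^typ>\<open>real \<times> real\<close> is the
  Euclidean one. The lateral desired values \<open>vy_des s\<close>, \<open>py_des s\<close> depend on the stance leg \<open>s\<close>.\<close>

record mpc_params =
  vx_des :: real
  px_des :: real
  vy_des :: "leg \<Rightarrow> real"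
  py_des :: "leg \<Rightarrow> real"
  k1 :: real
  k2 :: real
  k3 :: real
  k4 :: real
  eps_x :: real
  eps_y :: real

definition v_des :: "mpc_params \<Rightarrow> leg \<Rightarrow> real \<times> real" where
  "v_des P s = (vx_des P, vy_des P s)"

text \<open>The four stability constraints of the planning problem at a step \<open>i\<close> whose stance leg is
  \<open>s\<close>, for \<open>v1 = v\<^sup>+[i+1]\<close>, \<open>v2 = v\<^sup>+[i+2]\<close> and \<open>p2 = p\<^sup>+[i+2]\<close>. The stance leg is
  \<open>other_leg s\<close> in step \<open>i+1\<close> and \<open>s\<close> again in step \<open>i+2\<close>.\<close>

definition stability_constraints ::
  "mpc_params \<Rightarrow> leg \<Rightarrow> real \<times> real \<Rightarrow> real \<times> real \<Rightarrow> real \<times> real \<Rightarrow> bool" where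
  "stability_constraints P s v1 v2 p2 \<longleftrightarrow>
     \<bar>fst v2 - vx_des P\<bar> \<le> k1 P * \<bar>fst v1 - vx_des P\<bar> + eps_x P \<and>
     \<bar>snd v2 - vy_des P s\<bar> \<le> k2 P * \<bar>snd v1 - vy_des P (other_leg s)\<bar> + eps_y P \<and>
     \<bar>fst p2 - px_des P\<bar> \<le> k3 P * norm (v2 - v_des P s) \<and>
     \<bar>snd p2 - py_des P s\<bar> \<le> k4 P * norm (v2 - v_des P s)"

text \<open>The robot model, which is left arbitrary. A whole-body trajectory is a function
  \<open>\<phi> :: real \<Rightarrow> 'q\<close> into whole-body states, \<open>'n\<close> indexes the joints and \<open>'g\<close> is the type of
  ground reaction forces. The first four fields give the joint positions, joint velocities, joint
  torques and ground reaction forces that achieve \<open>\<phi>\<close> at a given time. \<open>com_pos s \<phi> t\<close> and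
  \<open>com_vel s \<phi> t\<close> are the horizontal centre-of-mass position and velocity, relative to the
  stance foot \<open>s\<close>, just after an impact at time \<open>t\<close> by which \<open>s\<close> becomes the stance leg.\<close>

record ('q, 'n, 'g) robot =
  joint_pos :: "(real \<Rightarrow> 'q) \<Rightarrow> real \<Rightarrow> real ^ 'n"
  joint_vel :: "(real \<Rightarrow> 'q) \<Rightarrow> real \<Rightarrow> real ^ 'n"
  joint_torque :: "(real \<Rightarrow> 'q) \<Rightarrow> real \<Rightarrow> real ^ 'n"
  ground_force :: "(real \<Rightarrow> 'q) \<Rightarrow> real \<Rightarrow> 'g"
  pos_limits :: "(real ^ 'n) set"
  vel_limits :: "(real ^ 'n) set"
  torque_limits :: "(real ^ 'n) set"
  force_limits :: "'g set"
  com_pos :: "leg \<Rightarrow> (real \<Rightarrow> 'q) \<Rightarrow> real \<Rightarrow> real \<times> real"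
  com_vel :: "leg \<Rightarrow> (real \<Rightarrow> 'q) \<Rightarrow> real \<Rightarrow> real \<times> real"

text \<open>A plan consists of a whole-body trajectory and the durations of the current and of the next
  step. Time is measured from the impact that started the current step, so the next two impacts
  take place at \<open>dur_cur\<close> and at \<open>dur_cur + dur_next\<close>.\<close>

record 'q plan =
  traj :: "real \<Rightarrow> 'q"
  dur_cur :: real
  dur_next :: real

definition horizon :: "real \<Rightarrow> 'q plan \<Rightarrow> real set" where
  "horizon t0 \<pi> = {t0 .. dur_cur \<pi> + dur_next \<pi>}"

definition squared_power ::
  "('q, 'n::finite, 'g) robot \<Rightarrow> (real \<Rightarrow> 'q) \<Rightarrow> real \<Rightarrow> real" where
  "squared_power M \<phi> t = (norm (joint_torque M \<phi> t \<bullet> joint_vel M \<phi> t))\<^sup>2"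

definition plan_cost :: "('q, 'n::finite, 'g) robot \<Rightarrow> real \<Rightarrow> 'q plan \<Rightarrow> real" where
  "plan_cost M t0 \<pi> = integral (horizon t0 \<pi>) (squared_power M (traj \<pi>))"

text \<open>Feasibility for the problem posed at time \<open>t0\<close> after the last impact in whole-body state
  \<open>x0\<close>, with stance leg \<open>s\<close>. Integrability is required because \<^const>\<open>integral\<close> has the value
  \<open>0\<close> on non-integrable functions, which would make such plans optimal.\<close>

definition feasible_plan ::
  "('q, 'n::finite, 'g) robot \<Rightarrow> mpc_params \<Rightarrow> leg \<Rightarrow> real \<Rightarrow> 'q \<Rightarrow> 'q plan \<Rightarrow> bool" where
  "feasible_plan M P s t0 x0 \<pi> \<longleftrightarrow>
     traj \<pi> t0 = x0 \<and>
     0 < dur_cur \<pi> \<and> t0 \<le> dur_cur \<pi> \<and> 0 < dur_next \<pi> \<and>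
     squared_power M (traj \<pi>) integrable_on horizon t0 \<pi> \<and>
     (\<forall>t \<in> horizon t0 \<pi>.
        joint_pos M (traj \<pi>) t \<in> pos_limits M \<and>
        joint_vel M (traj \<pi>) t \<in> vel_limits M \<and>
        joint_torque M (traj \<pi>) t \<in> torque_limits M \<and>
        ground_force M (traj \<pi>) t \<in> force_limits M) \<and>
     stability_constraints P s
       (com_vel M (other_leg s) (traj \<pi>) (dur_cur \<pi>))
       (com_vel M s (traj \<pi>) (dur_cur \<pi> + dur_next \<pi>))
       (com_pos M s (traj \<pi>) (dur_cur \<pi> + dur_next \<pi>))"

definition optimal_plan ::
  "('q, 'n::finite, 'g) robot \<Rightarrow> mpc_params \<Rightarrow> leg \<Rightarrow> real \<Rightarrow> 'q \<Rightarrow> 'q plan \<Rightarrow> bool" where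
  "optimal_plan M P s t0 x0 \<pi> \<longleftrightarrow>
     feasible_plan M P s t0 x0 \<pi> \<and>
     (\<forall>\<pi>'. feasible_plan M P s t0 x0 \<pi>' \<longrightarrow> plan_cost M t0 \<pi> \<le> plan_cost M t0 \<pi>')"

text \<open>The sequences \<open>v\<close>, \<open>p\<close> result from applying, in every step \<open>i\<close>, a solution of the planning
  problem up to the impact that starts step \<open>i+1\<close>; their values at index \<open>0\<close> play no role.\<close>

definition results_from_mpc ::
  "('q, 'n::finite, 'g) robot \<Rightarrow> mpc_params \<Rightarrow> leg \<Rightarrow>
     (nat \<Rightarrow> real \<times> real) \<Rightarrow> (nat \<Rightarrow> real \<times> real) \<Rightarrow> bool" where
  "results_from_mpc M P s0 v p \<longleftrightarrow>
     (\<forall>i. \<exists>t0 x0 \<pi>. 0 \<le> t0 \<and> optimal_plan M P (stance s0 i) t0 x0 \<pi> \<and>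
        v (i + 1) = com_vel M (stance s0 (i + 1)) (traj \<pi>) (dur_cur \<pi>) \<and>
        p (i + 1) = com_pos M (stance s0 (i + 1)) (traj \<pi>) (dur_cur \<pi>))"

text \<open>The stability constraints along the realized sequence. Because of the replanning in step
  \<open>i+1\<close>, the realized \<open>v (i + 2)\<close> need not be the one predicted by the plan of step \<open>i\<close>, so this
  is not a formal consequence of \<^const>\<open>results_from_mpc\<close>.\<close>

definition stability_along ::
  "mpc_params \<Rightarrow> leg \<Rightarrow> (nat \<Rightarrow> real \<times> real) \<Rightarrow> (nat \<Rightarrow> real \<times> real) \<Rightarrow> bool" where
  "stability_along P s0 v p \<longleftrightarrow>
     (\<forall>i. stability_constraints P (stance s0 i) (v (i + 1)) (v (i + 2)) (p (i + 2)))"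

end

theory Submission
  imports Defs
begin

text \<open>Since the stance legs alternate, both components of the error \<open>v i - v_des P (stance s0 i)\<close>
  satisfy a scalar recursion \<open>x (i + 1) \<le> k * x i + e\<close> with \<open>k < 1\<close>. Hence each of them is
  eventually at most \<open>1 + e / (1 - k)\<close>, after a number of steps that depends only on \<open>k\<close> and on a
  bound on the initial error. The bound is global, so that \<open>c\<close> may be chosen arbitrarily.\<close>

lemma stance_Suc: "stance s0 (Suc i) = other_leg (stance s0 i)"
  by (cases s0) (auto simp: stance_def)

text \<open>\<open>e / (1 - k)\<close> is the fixed point of the map t -> k * t + e, so it
  reproduces itself in the induction step, while the transient term gains one factor
  \<open>k\<close>.\<close>

lemma affine_recursion_bound:
  fixes x :: "nat \<Rightarrow> real"
  assumes k: "0 \<le> k" "k < 1" and e: "0 \<le> e"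
    and step: "\<And>i. m \<le> i \<Longrightarrow> x (Suc i) \<le> k * x i + e"
  shows "x (m + n) \<le> k ^ n * x m + e / (1 - k)"
proof (induction n)
  case 0
  show ?case using k e by simp
next
  case (Suc n)
  have "x (m + Suc n) \<le> k * x (m + n) + e"
    using step[of "m + n"] by simp
  also have "\<dots> \<le> k * (k ^ n * x m + e / (1 - k)) + e"
    using Suc.IH k by (intro add_right_mono mult_left_mono) auto
  also have "\<dots> = k ^ Suc n * x m + e / (1 - k)"
    using k by (simp add: field_simps)
  finally show ?case .
qed

text \<open>The transient \<open>k ^ n * a\<close> tends to 0 and so drops below 1. \<open>N\<close>
  is obtained before the sequence and the starting index are fixed; the uniformity in the theorem
  rests on this order.\<close>

lemma affine_recursion_ultimate_bound:
  fixes k e a :: real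
  assumes k: "0 \<le> k" "k < 1" and e: "0 \<le> e" and a: "0 \<le> a"
  obtains N where "\<And>x m i. \<lbrakk>\<And>j. m \<le> j \<Longrightarrow> x (Suc j) \<le> k * x j + e; x m \<le> a; m + N \<le> i\<rbrakk>
    \<Longrightarrow> x i \<le> 1 + e / (1 - k)"
proof -
  \<comment> \<open>The threshold \<open>1 / (a + 1)\<close> gives \<open>k ^ N * a\<close> \<le> 1
    and remains meaningful for \<open>a = 0\<close>.\<close>
  obtain N where N: "k ^ N < 1 / (a + 1)"
    using real_arch_pow_inv[of "1 / (a + 1)" k] k a by auto
  show thesis
  proof (rule that[of N])
    fix x :: "nat \<Rightarrow> real" and m i
    assume step: "\<And>j. m \<le> j \<Longrightarrow> x (Suc j) \<le> k * x j + e" and xm: "x m \<le> a" and i: "m + N \<le> i"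
    have "k ^ (i - m) * x m \<le> k ^ (i - m) * a"
      using k xm by (intro mult_left_mono) auto
    also have "\<dots> \<le> k ^ N * a"
      using k a i by (intro mult_right_mono power_decreasing) auto
    also have "\<dots> \<le> 1 / (a + 1) * a"
      using N a by (intro mult_right_mono) auto
    also have "\<dots> \<le> 1"
      using a by simp
    finally show "x i \<le> 1 + e / (1 - k)"
      using affine_recursion_bound[of k e m x "i - m", OF k e step] i by simp
  qed
qed

theorem theorem1p1:
  fixes P :: mpc_params
  assumes "0 < k1 P" "k1 P < 1" "0 < k2 P" "k2 P < 1"
    and "0 < k3 P" "0 < k4 P"
    and "0 \<le> eps_x P" "0 \<le> eps_y P"
  shows "\<exists>b c :: real. 0 < b \<and> 0 < c \<and>
    (\<forall>a. 0 < a \<and> a < c \<longrightarrow>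
      (\<exists>N::nat. 0 < N \<and>
        (\<forall>(M :: ('q, 'n::finite, 'g) robot) s0 v p.
          results_from_mpc M P s0 v p \<and> stability_along P s0 v p \<longrightarrow>
          (\<forall>i0\<ge>1. norm (v i0 - v_des P (stance s0 i0)) \<le> a \<longrightarrow>
            (\<forall>i\<ge>i0 + N. norm (v i - v_des P (stance s0 i)) \<le> b)))))"
proof -
  \<comment> \<open>Fixed point of each scalar recursion plus a slack of 1, which absorbs the
    transient after finitely many steps.\<close>
  define bx where "bx = 1 + eps_x P / (1 - k1 P)"
  define b_y where "b_y = 1 + eps_y P / (1 - k2 P)"
  have "\<exists>N::nat. 0 < N \<and>
        (\<forall>(M :: ('q, 'n, 'g) robot) s0 v p.
          results_from_mpc M P s0 v p \<and> stability_along P s0 v p \<longrightarrow>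
          (\<forall>i0\<ge>1. norm (v i0 - v_des P (stance s0 i0)) \<le> a \<longrightarrow>
            (\<forall>i\<ge>i0 + N. norm (v i - v_des P (stance s0 i)) \<le> bx + b_y)))"
    if a: "0 < a" for a
  proof -
    obtain Nx where Nx: "\<And>x m i. \<lbrakk>\<And>j. m \<le> j \<Longrightarrow> x (Suc j) \<le> k1 P * x j + eps_x P; x m \<le> a;
        m + Nx \<le> i\<rbrakk> \<Longrightarrow> x i \<le> bx"
      using affine_recursion_ultimate_bound[of "k1 P" "eps_x P" a] assms a
      unfolding bx_def by auto
    obtain Ny where Ny: "\<And>x m i. \<lbrakk>\<And>j. m \<le> j \<Longrightarrow> x (Suc j) \<le> k2 P * x j + eps_y P; x m \<le> a;
        m + Ny \<le> i\<rbrakk> \<Longrightarrow> x i \<le> b_y"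
      using affine_recursion_ultimate_bound[of "k2 P" "eps_y P" a] assms a
      unfolding b_y_def by auto
    have "norm (v i - v_des P (stance s0 i)) \<le> bx + b_y"
      if stab: "stability_along P s0 v p" and i0: "1 \<le> i0"
        and init: "norm (v i0 - v_des P (stance s0 i0)) \<le> a" and i: "i0 + Suc (Nx + Ny) \<le> i"
      for s0 v p i0 i
    proof -
      define d where "d j = v j - v_des P (stance s0 j)" for j
      have step: "\<bar>fst (d (Suc j))\<bar> \<le> k1 P * \<bar>fst (d j)\<bar> + eps_x P \<and>
          \<bar>snd (d (Suc j))\<bar> \<le> k2 P * \<bar>snd (d j)\<bar> + eps_y P" if j0: "i0 \<le> j" for j
      proof -
        \<comment> \<open>The constraints of step \<open>l\<close> relate \<open>v (l + 1)\<close>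
          to \<open>v (l + 2)\<close>, so passing from \<open>j\<close> to \<open>Suc j\<close> uses
          step \<open>j - 1\<close>. This is where \<open>1 \<le> i0\<close> enters.\<close>
        obtain l where j: "j = Suc l"
          using i0 j0 by (cases j) auto
        \<comment> \<open>The stance leg of step \<open>l + 2\<close> is that of step
          \<open>l\<close> again, so both lateral targets in the constraint match those in
          \<open>d\<close>.\<close>
        have "other_leg (other_leg s) = s" for s
          by (cases s) auto
        then show ?thesis
          using stab unfolding stability_along_def stability_constraints_def d_def v_des_def j
          by (auto simp: stance_Suc)
      qed
      have "\<bar>fst (d i0)\<bar> \<le> a" "\<bar>snd (d i0)\<bar> \<le> a"
        using init[folded d_def] norm_fst_le[of "fst (d i0)" "snd (d i0)"]
          norm_snd_le[of "snd (d i0)" "fst (d i0)"]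
        by auto
      then have "\<bar>fst (d i)\<bar> \<le> bx" "\<bar>snd (d i)\<bar> \<le> b_y"
        using Nx[of i0 "\<lambda>j. \<bar>fst (d j)\<bar>" i] Ny[of i0 "\<lambda>j. \<bar>snd (d j)\<bar>" i] step i by auto
      then show ?thesis
        using norm_Pair_le[of "fst (d i)" "snd (d i)"] by (simp flip: d_def)
    qed
    \<comment> \<open>\<open>Nx + Ny\<close> steps suffice for both components at once;
      \<open>Suc\<close> makes the number positive.\<close>
    then show ?thesis
      by (intro exI[of _ "Suc (Nx + Ny)"]) blast
  qed
  moreover have "0 < bx + b_y"
    using assms by (simp add: bx_def b_y_def add_pos_nonneg)
  ultimately show ?thesis
    by (intro exI[of _ "bx + b_y"] exI[of _ 1]) simp
qed

end
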